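(* Let $1\le k<n$, let $K\in\mathbb{R}^{n\times n}$ be symmetric positive semidefinite, let $\eta>0$, and let $\Lambda_k$, $V_k$ be as in the eigendecomposition of $K$ described in the context. Let $S_{\rm opt}\in\mathbb{R}^{n\times k}$ be a selection operator maximizing $\phi_D$ over all selection operators with $k$ columns. Then for any selection operator $S\in\mathbb{R}^{n\times k}$ such that $\operatorname{rank}(V_k^\top S)=k$, $$\log\det\left(I_k+\eta^{-2}\Lambda_k\right)\ \ge\ \phi_D(S_{\rm opt})\ \ge\ \phi_D(S)\ \ge\ \log\det\left(I_k+\frac{\eta^{-2}\Lambda_k}{\|[V_k^\top S]^{-1}\|_2^2}\right).$$
   Context: $\|\cdot\|_2$ is the spectral norm. A selection operator $S\in\mathbb{R}^{n\times k}$ is a matrix $S=[e_{i_1}\ \cdots\ e_{i_k}]$ whose columns are $k$ distinct columns of the identity matrix $I_n$. For a symmetric positive semidefinite matrix $K\in\mathbb{R}^{n\times n}$ (the covariance matrix of the candidate sensors) and noise level $\eta>0$, the D-optimality criterion is $\phi_D(S):=\log\det(\eta^{-2}S^\top K S+I_k)$. Eigenvalues are in non-increasing order $\lambda_1(K)\ge\dots\ge\lambda_n(K)\ge 0$. Write an eigendecomposition $K=V\Lambda V^\top$ with $V$ orthogonal and $\Lambda=\operatorname{diag}(\lambda_1(K),\dots,\lambda_n(K))$; $V_k\in\mathbb{R}^{n\times k}$ denotes the first $k$ columns of $V$ and $\Lambda_k=\operatorname{diag}(\lambda_1(K),\dots,\lambda_k(K))$. *)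

theory Defs
  imports
    Complex_Main
    "HOL-Computational_Algebra.Polynomial"
    "Jordan_Normal_Form.Char_Poly"
    "Jordan_Normal_Form.Gauss_Jordan_Elimination"
    "Jordan_Normal_Form.DL_Rank"
begin

definition psd_mat :: "nat \<Rightarrow> real mat \<Rightarrow> bool" where
  "psd_mat n K \<longleftrightarrow> K \<in> carrier_mat n n \<and> transpose_mat K = K \<and>
     (\<forall>x \<in> carrier_vec n. 0 \<le> x \<bullet> (K *\<^sub>v x))"

(* The library predicate orthogonal_mat only asks for nonzero, pairwise orthogonal columns. *)
definition orthonormal_mat :: "nat \<Rightarrow> real mat \<Rightarrow> bool" where
  "orthonormal_mat n V \<longleftrightarrow> V \<in> carrier_mat n n \<and> transpose_mat V * V = 1\<^sub>m n \<and> V * transpose_mat V = 1\<^sub>m n"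

(* Indices start at 0: eigval K j is the (j+1)-st largest eigenvalue of K, counted with
   algebraic multiplicity. Meaningful for j < n when K is a symmetric n x n matrix, whose
   characteristic polynomial splits over the reals. *)
definition eigval :: "real mat \<Rightarrow> nat \<Rightarrow> real" where
  "eigval K j = rev (sorted_list_of_multiset (proots (char_poly K))) ! j"

definition eigendecomposition :: "nat \<Rightarrow> real mat \<Rightarrow> real mat \<Rightarrow> bool" where
  "eigendecomposition n K V \<longleftrightarrow> orthonormal_mat n V \<and>
     K = V * mat_diag n (eigval K) * transpose_mat V"

definition first_cols :: "nat \<Rightarrow> real mat \<Rightarrow> real mat" where
  "first_cols k V = mat_of_cols (dim_row V) (take k (cols V))"

definition selection_op :: "nat \<Rightarrow> nat \<Rightarrow> real mat \<Rightarrow> bool" where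
  "selection_op n k S \<longleftrightarrow> (\<exists>is. length is = k \<and> distinct is \<and> set is \<subseteq> {..<n} \<and>
     S = mat_of_cols n (map (unit_vec n) is))"

definition vec_norm2 :: "real vec \<Rightarrow> real" where
  "vec_norm2 x = sqrt (x \<bullet> x)"

(* For dim_col A = 0 there are no unit vectors and the value is unspecified. *)
definition spectral_norm :: "real mat \<Rightarrow> real" where
  "spectral_norm A = (SUP x \<in> {x \<in> carrier_vec (dim_col A). vec_norm2 x = 1}. vec_norm2 (A *\<^sub>v x))"

(* Intended for invertible square A; mat_inverse returns None otherwise. *)
definition mat_inv :: "real mat \<Rightarrow> real mat" where
  "mat_inv A = the (mat_inverse A)"

definition phi_D :: "real \<Rightarrow> real mat \<Rightarrow> real mat \<Rightarrow> real" where
  "phi_D \<eta> K S = ln (det ((1 / \<eta>\<^sup>2) \<cdot>\<^sub>m (transpose_mat S * K * S) + 1\<^sub>m (dim_col S)))"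

definition D_optimal :: "nat \<Rightarrow> nat \<Rightarrow> real \<Rightarrow> real mat \<Rightarrow> real mat \<Rightarrow> bool" where
  "D_optimal n k \<eta> K S \<longleftrightarrow> selection_op n k S \<and>
     (\<forall>T. selection_op n k T \<longrightarrow> phi_D \<eta> K T \<le> phi_D \<eta> K S)"

end

theory Submission
  imports Defs
begin

text \<open>
  Write \<open>c = 1 / \<eta>\<^sup>2\<close>, let \<open>\<lambda>\<^sub>0 \<ge> \<lambda>\<^sub>1 \<ge> \<dots>\<close> be the eigenvalues of \<open>K\<close>, and put
  \<open>G = c S\<^sup>T K S + I\<close> and \<open>Y = V\<^sub>k\<^sup>T S\<close>. In the eigenvector coordinates \<open>p = V\<^sup>T S x\<close> the
  quadratic form of \<open>G\<close> is \<open>|x|\<^sup>2 + c (\<Sum>i<n. \<lambda>\<^sub>i p\<^sub>i\<^sup>2)\<close>, where \<open>|p| = |x|\<close> and \<open>Y x\<close> is the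
  vector of the first \<open>k\<close> coordinates of \<open>p\<close>. Both bounds sandwich this form between forms
  that involve only \<open>Y\<close>, and then use that the determinant is monotone for the order of
  quadratic forms on positive definite matrices (\<open>det_mono_pos_def\<close>).

  For the lower bound, dropping the coordinates \<open>i \<ge> k\<close> gives \<open>G \<ge> I + X\<^sup>T X\<close> with
  \<open>X = (c \<Lambda>\<^sub>k)\<^sup>1\<^sup>/\<^sup>2 Y\<close>. By the identity \<open>det (I + X\<^sup>T X) = det (I + X X\<^sup>T)\<close>
  (\<open>det_one_plus_mult_commute\<close>) the factor \<open>Y\<close> moves to the inside, where
  \<open>Y Y\<^sup>T \<ge> s I\<close> with \<open>s\<close> the inverse square of the spectral norm of \<open>Y\<^sup>-\<^sup>1\<close>. A second use of
  monotonicity yields \<open>det (I + s c \<Lambda>\<^sub>k)\<close>.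

  For the upper bound, replacing every \<open>\<lambda>\<^sub>i\<close> with \<open>i \<ge> k\<close> by \<open>l = \<lambda>\<^sub>k\<^sub>-\<^sub>1\<close> gives
  \<open>G \<le> (1 + c l) I + Y\<^sup>T D Y\<close>, where \<open>D = c (\<Lambda>\<^sub>k - l I)\<close> is nonnegative. The same exchange,
  now with \<open>Y Y\<^sup>T \<le> I\<close>, bounds the determinant by \<open>det ((1 + c l) I + D) = det (I + c \<Lambda>\<^sub>k)\<close>.
\<close>

section \<open>Monotonicity of the determinant on positive definite matrices\<close>


definition quad_form :: "nat \<Rightarrow> (nat \<Rightarrow> nat \<Rightarrow> real) \<Rightarrow> (nat \<Rightarrow> real) \<Rightarrow> real" where
  "quad_form n f x = (\<Sum>i<n. \<Sum>j<n. x i * f i j * x j)"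

definition schur_complement :: "(nat \<Rightarrow> nat \<Rightarrow> real) \<Rightarrow> nat \<Rightarrow> nat \<Rightarrow> real" where
  "schur_complement f i j = f (Suc i) (Suc j) - f (Suc i) 0 * f 0 (Suc j) / f 0 0"

abbreviation fun_mat :: "nat \<Rightarrow> (nat \<Rightarrow> nat \<Rightarrow> real) \<Rightarrow> real mat" where
  "fun_mat n f \<equiv> mat n n (\<lambda>(i, j). f i j)"

lemma quad_form_Suc:
  assumes sym: "\<And>i j. i < Suc n \<Longrightarrow> j < Suc n \<Longrightarrow> f i j = f j i"
  shows "quad_form (Suc n) f x = f 0 0 * (x 0)\<^sup>2 + 2 * x 0 * (\<Sum>j<n. f 0 (Suc j) * x (Suc j))
    + quad_form n (\<lambda>i j. f (Suc i) (Suc j)) (x \<circ> Suc)"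
proof -
  have "(\<Sum>i<n. x (Suc i) * f (Suc i) 0 * x 0) = x 0 * (\<Sum>j<n. f 0 (Suc j) * x (Suc j))"
    unfolding sum_distrib_left by (rule sum.cong) (auto simp: sym)
  moreover have "(\<Sum>j<n. x 0 * f 0 (Suc j) * x (Suc j)) = x 0 * (\<Sum>j<n. f 0 (Suc j) * x (Suc j))"
    by (simp add: sum_distrib_left mult.assoc)
  ultimately show ?thesis
    unfolding quad_form_def
    by (simp add: sum.lessThan_Suc_shift sum.distrib power2_eq_square del: sum.lessThan_Suc)
qed

text \<open>
  Completing the square in the first variable. Hence, for positive \<open>f 0 0\<close>, the form of the
  Schur complement is the minimum of the form of \<open>f\<close> over that variable.
\<close>
lemma quad_form_schur:
  assumes sym: "\<And>i j. i < Suc n \<Longrightarrow> j < Suc n \<Longrightarrow> f i j = f j i" and a: "f 0 0 \<noteq> 0"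
  shows "quad_form (Suc n) f x =
    f 0 0 * (x 0 + (\<Sum>j<n. f 0 (Suc j) * x (Suc j)) / f 0 0)\<^sup>2 + quad_form n (schur_complement f) (x \<circ> Suc)"
proof -
  define u where "u = (\<Sum>j<n. f 0 (Suc j) * x (Suc j))"
  have u': "u = (\<Sum>j<n. x (Suc j) * f (Suc j) 0)"
    unfolding u_def by (rule sum.cong) (auto simp: sym)
  have "u * u = (\<Sum>i<n. \<Sum>j<n. (x (Suc i) * f (Suc i) 0) * (f 0 (Suc j) * x (Suc j)))"
    by (subst u', subst u_def, rule sum_product)
  hence "u * u / f 0 0 =
      (\<Sum>i<n. \<Sum>j<n. x (Suc i) * (f (Suc i) 0 * f 0 (Suc j) / f 0 0) * x (Suc j))"
    by (simp add: sum_divide_distrib mult_ac)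
  hence q: "quad_form n (schur_complement f) (x \<circ> Suc) =
      quad_form n (\<lambda>i j. f (Suc i) (Suc j)) (x \<circ> Suc) - u * u / f 0 0"
    unfolding quad_form_def schur_complement_def
    by (simp add: right_diff_distrib left_diff_distrib sum_subtractf)
  have s: "f 0 0 * (x 0 + u / f 0 0)\<^sup>2 = f 0 0 * (x 0)\<^sup>2 + 2 * x 0 * u + u * u / f 0 0"
    using a by (simp add: power2_eq_square field_simps)
  show ?thesis
    using q s unfolding quad_form_Suc[of n f x, OF sym, simplified] u_def by simp
qed

lemma det_schur:
  assumes a: "f 0 0 \<noteq> 0"
  shows "det (fun_mat (Suc n) f) = f 0 0 * det (fun_mat n (schur_complement f))"
proof -
  define A1 where "A1 = mat 1 1 (\<lambda>_. f 0 0)"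
  define A2 where "A2 = mat 1 n (\<lambda>(i, j). f 0 (Suc j))"
  define L where "L = mat n 1 (\<lambda>(i, j). f (Suc i) 0 / f 0 0)"
  let ?S = "fun_mat n (schur_complement f)"
  have c: "A1 \<in> carrier_mat 1 1" "A2 \<in> carrier_mat 1 n" "L \<in> carrier_mat n 1" "?S \<in> carrier_mat n n"
    by (auto simp: A1_def A2_def L_def)
  \<comment> \<open>One step of Gaussian elimination, as a factorization into block triangular matrices.\<close>
  have "four_block_mat (1\<^sub>m 1) (0\<^sub>m 1 n) L (1\<^sub>m n) * four_block_mat A1 A2 (0\<^sub>m n 1) ?S
      = four_block_mat A1 A2 (L * A1) (L * A2 + ?S)"
    using c by (subst mult_four_block_mat[of _ 1 1 _ n _ n _ _ 1 _ n]) auto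
  also have "\<dots> = fun_mat (Suc n) f"
    using a
    by (intro eq_matI)
      (auto simp: A1_def A2_def L_def schur_complement_def scalar_prod_def not_less Suc_le_eq gr0_conv_Suc)
  finally have eq: "fun_mat (Suc n) f =
      four_block_mat (1\<^sub>m 1) (0\<^sub>m 1 n) L (1\<^sub>m n) * four_block_mat A1 A2 (0\<^sub>m n 1) ?S" by simp
  have "det (four_block_mat (1\<^sub>m 1) (0\<^sub>m 1 n) L (1\<^sub>m n)) = 1"
    using c by (subst det_four_block_mat_upper_right_zero[of _ 1 _ n]) auto
  moreover have "det (four_block_mat A1 A2 (0\<^sub>m n 1) ?S) = f 0 0 * det ?S"
    using c by (subst det_four_block_mat_lower_left_zero[of _ 1 _ n]) (auto simp: A1_def det_single)
  ultimately show ?thesis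
    unfolding eq using c by (subst det_mult[of _ "1 + n"]) (auto intro!: four_block_carrier_mat)
qed

text \<open>
  The Schur complement is a partial minimum of the form, so it inherits positivity and the
  comparison between the two forms. The pivots are values of the forms at the first unit
  vector, hence also ordered, and the determinant is the pivot times the determinant of the
  Schur complement.
\<close>
lemma det_fun_mat_mono:
  assumes "\<And>i j. i < n \<Longrightarrow> j < n \<Longrightarrow> f i j = f j i"
    and "\<And>i j. i < n \<Longrightarrow> j < n \<Longrightarrow> g i j = g j i"
    and "\<And>x. \<exists>i<n. x i \<noteq> 0 \<Longrightarrow> 0 < quad_form n f x"
    and "\<And>x. quad_form n f x \<le> quad_form n g x"
  shows "0 < det (fun_mat n f) \<and> det (fun_mat n f) \<le> det (fun_mat n g)"
  using assms
proof (induction n arbitrary: f g)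
  case 0
  show ?case by (simp add: det_def)
next
  case (Suc n)
  note symf = Suc.prems(1) and symg = Suc.prems(2) and pos = Suc.prems(3) and le = Suc.prems(4)
  define e :: "nat \<Rightarrow> real" where "e i = (if i = 0 then 1 else 0)" for i
  have "quad_form (Suc n) f e = f 0 0" "quad_form (Suc n) g e = g 0 0"
    by (subst quad_form_Suc, fact, simp add: e_def quad_form_def)+
  moreover have "0 < quad_form (Suc n) f e"
    by (rule pos) (auto simp: e_def)
  ultimately have f0: "0 < f 0 0" and fg0: "f 0 0 \<le> g 0 0"
    using le[of e] by auto
  \<comment> \<open>\<open>?min h y\<close> extends \<open>y\<close> by the first coordinate that minimizes the form of \<open>h\<close>.\<close>
  let ?min = "\<lambda>f y. case_nat (- (\<Sum>j<n. f 0 (Suc j) * y j) / f 0 0) y"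
  have at_min: "quad_form (Suc n) h (?min h y) = quad_form n (schur_complement h) y"
    if "h 0 0 > 0" "\<And>i j. i < Suc n \<Longrightarrow> j < Suc n \<Longrightarrow> h i j = h j i" for h y
    using that by (subst quad_form_schur) (auto simp: o_def)
  have above_min: "quad_form n (schur_complement f) y \<le> quad_form (Suc n) f (case_nat s y)" for s y
    using f0 symf by (subst quad_form_schur) (auto simp: o_def)
  have IH: "0 < det (fun_mat n (schur_complement f)) \<and> det (fun_mat n (schur_complement f)) \<le> det (fun_mat n (schur_complement g))"
  proof (rule Suc.IH)
    show "schur_complement f i j = schur_complement f j i" if "i < n" "j < n" for i j
      using that symf[of "Suc i" "Suc j"] symf[of "Suc i" 0] symf[of "Suc j" 0]
      by (simp add: schur_complement_def mult.commute)
    show "schur_complement g i j = schur_complement g j i" if "i < n" "j < n" for i j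
      using that symg[of "Suc i" "Suc j"] symg[of "Suc i" 0] symg[of "Suc j" 0]
      by (simp add: schur_complement_def mult.commute)
    show "0 < quad_form n (schur_complement f) y" if "\<exists>i<n. y i \<noteq> 0" for y
    proof -
      have "\<exists>i<Suc n. ?min f y i \<noteq> 0"
        using that by force
      from pos[OF this] show ?thesis
        using at_min[of f y] f0 symf by simp
    qed
    show "quad_form n (schur_complement f) y \<le> quad_form n (schur_complement g) y" for y
    proof -
      \<comment> \<open>Any extension of \<open>y\<close> bounds the minimum for \<open>f\<close> from above; take the one optimal for \<open>g\<close>.\<close>
      have "quad_form n (schur_complement f) y \<le> quad_form (Suc n) f (?min g y)"
        by (rule above_min)
      also have "\<dots> \<le> quad_form (Suc n) g (?min g y)"
        by (rule le)
      also have "\<dots> = quad_form n (schur_complement g) y"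
        using f0 fg0 symg by (intro at_min) auto
      finally show ?thesis .
    qed
  qed
  have "f 0 0 * det (fun_mat n (schur_complement f)) \<le> g 0 0 * det (fun_mat n (schur_complement g))"
    using IH f0 fg0 by (intro mult_mono) auto
  then show ?case
    using IH f0 fg0 by (simp add: det_schur)
qed

lemma scalar_prod_mult_mat_vec:
  fixes A :: "real mat"
  assumes "A \<in> carrier_mat n n"
  shows "vec n x \<bullet> (A *\<^sub>v vec n x) = quad_form n (\<lambda>i j. A $$ (i, j)) x"
  using assms
  by (auto simp: scalar_prod_def quad_form_def sum_distrib_left lessThan_atLeast0 mult.assoc
      intro!: sum.cong)

lemma det_mono_pos_def:
  fixes A B :: "real mat"
  assumes A: "A \<in> carrier_mat n n" "transpose_mat A = A"
    and B: "B \<in> carrier_mat n n" "transpose_mat B = B"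
    and pos: "\<And>x. x \<in> carrier_vec n \<Longrightarrow> x \<noteq> 0\<^sub>v n \<Longrightarrow> 0 < x \<bullet> (A *\<^sub>v x)"
    and le: "\<And>x. x \<in> carrier_vec n \<Longrightarrow> x \<bullet> (A *\<^sub>v x) \<le> x \<bullet> (B *\<^sub>v x)"
  shows "0 < det A" "det A \<le> det B"
proof -
  have sym: "M $$ (i, j) = M $$ (j, i)"
    if "M \<in> carrier_mat n n" "transpose_mat M = M" "i < n" "j < n" for M :: "real mat" and i j
    using that by (metis carrier_matD index_transpose_mat(1))
  have mat: "M = fun_mat n (\<lambda>i j. M $$ (i, j))" if "M \<in> carrier_mat n n" for M :: "real mat"
    using that by (intro eq_matI) auto
  have nz: "vec n x \<noteq> 0\<^sub>v n" if "\<exists>i<n. x i \<noteq> 0" for x :: "nat \<Rightarrow> real"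
    using that by (metis index_vec index_zero_vec(1))
  have "0 < det (fun_mat n (\<lambda>i j. A $$ (i, j))) \<and>
      det (fun_mat n (\<lambda>i j. A $$ (i, j))) \<le> det (fun_mat n (\<lambda>i j. B $$ (i, j)))"
    using sym[OF A] sym[OF B] pos[OF vec_carrier nz] le[OF vec_carrier]
    by (intro det_fun_mat_mono) (simp_all add: scalar_prod_mult_mat_vec A(1) B(1) vec_def[symmetric])
  with mat[OF A(1)] mat[OF B(1)] show "0 < det A" "det A \<le> det B"
    by auto
qed

section \<open>The determinant identity for exchanged factors\<close>

text \<open>
  Sylvester's identity: the block matrix with rows \<open>(I, A)\<close> and \<open>(- B, I)\<close> has two block
  triangular factorizations, one through each of its diagonal blocks.
\<close>
lemma det_one_plus_mult_commute:
  fixes A B :: "'a :: idom mat"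
  assumes A: "A \<in> carrier_mat n m" and B: "B \<in> carrier_mat m n"
  shows "det (1\<^sub>m n + A * B) = det (1\<^sub>m m + B * A)"
proof -
  let ?L = "four_block_mat (1\<^sub>m n) (0\<^sub>m n m) (- B) (1\<^sub>m m)"
  let ?U1 = "four_block_mat (1\<^sub>m n) A (0\<^sub>m m n) (1\<^sub>m m + B * A)"
  let ?U2 = "four_block_mat (1\<^sub>m n + A * B) A (0\<^sub>m m n) (1\<^sub>m m)"
  have c: "?L \<in> carrier_mat (n + m) (n + m)" "?U1 \<in> carrier_mat (n + m) (n + m)"
      "?U2 \<in> carrier_mat (n + m) (n + m)"
    using A B by auto
  have "- B * A + (1\<^sub>m m + B * A) = 1\<^sub>m m"
    using A B by (intro eq_matI) auto
  hence 1: "?L * ?U1 = four_block_mat (1\<^sub>m n) A (- B) (1\<^sub>m m)"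
    using A B by (subst mult_four_block_mat[of _ n n _ m _ m _ _ n _ m]) auto
  have "1\<^sub>m n + A * B + A * - B = 1\<^sub>m n"
    using A B by (intro eq_matI) auto
  hence 2: "?U2 * ?L = four_block_mat (1\<^sub>m n) A (- B) (1\<^sub>m m)"
    using A B by (subst mult_four_block_mat[of _ n n _ m _ m _ _ n _ m]) auto
  have "det ?L * det ?U1 = det ?U2 * det ?L"
    using 1 2 c by (metis det_mult)
  moreover have "det ?L = 1"
    using A B by (subst det_four_block_mat_upper_right_zero[of _ n _ m]) auto
  moreover have "det ?U1 = det (1\<^sub>m m + B * A)"
    using A B by (subst det_four_block_mat_lower_left_zero[of _ n _ m]) auto
  moreover have "det ?U2 = det (1\<^sub>m n + A * B)"
    using A B by (subst det_four_block_mat_lower_left_zero[of _ n _ m]) auto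
  ultimately show ?thesis by simp
qed



section \<open>Lengths of vectors and the spectral norm\<close>

lemma scalar_prod_square:
  fixes x :: "real vec"
  assumes "x \<in> carrier_vec n"
  shows "x \<bullet> x = (\<Sum>i<n. (x $ i)\<^sup>2)"
  using assms by (auto simp: scalar_prod_def power2_eq_square lessThan_atLeast0)

lemma scalar_prod_self_nonneg: "0 \<le> (x :: real vec) \<bullet> x"
  by (simp add: scalar_prod_def sum_nonneg)

lemma scalar_prod_self_pos:
  fixes x :: "real vec"
  assumes "x \<in> carrier_vec n" "x \<noteq> 0\<^sub>v n"
  shows "0 < x \<bullet> x"
proof -
  from assms obtain i where "i < n" "x $ i \<noteq> 0"
    by (metis carrier_vecD eq_vecI index_zero_vec)
  then show ?thesis
    unfolding scalar_prod_square[OF assms(1)] by (intro sum_pos2[of _ i]) auto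
qed

lemma scalar_prod_Cauchy_Schwarz:
  fixes x y :: "real vec"
  assumes "x \<in> carrier_vec n" "y \<in> carrier_vec n"
  shows "(x \<bullet> y)\<^sup>2 \<le> (x \<bullet> x) * (y \<bullet> y)"
proof -
  define a b c where "a = x \<bullet> x" and "b = x \<bullet> y" and "c = y \<bullet> y"
  have a: "a = (\<Sum>i<n. (x $ i)\<^sup>2)" and c: "c = (\<Sum>i<n. (y $ i)\<^sup>2)"
    unfolding a_def c_def using assms by (simp_all add: scalar_prod_square)
  have b: "b = (\<Sum>i<n. x $ i * y $ i)"
    unfolding b_def using assms by (auto simp: scalar_prod_def lessThan_atLeast0)
  \<comment> \<open>The vector \<open>a y - b x\<close> is orthogonal to \<open>x\<close>; its squared length is \<open>a (a c - b\<^sup>2)\<close>.\<close>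
  have "0 \<le> (\<Sum>i<n. (a * y $ i - b * x $ i)\<^sup>2)"
    by (rule sum_nonneg) simp
  also have "\<dots> = (\<Sum>i<n. a\<^sup>2 * (y $ i)\<^sup>2 - 2 * a * b * (x $ i * y $ i) + b\<^sup>2 * (x $ i)\<^sup>2)"
    by (rule sum.cong) (auto simp: power2_eq_square algebra_simps)
  also have "\<dots> = a\<^sup>2 * c - 2 * a * b * b + b\<^sup>2 * a"
    unfolding sum.distrib sum_subtractf sum_distrib_left[symmetric] a[symmetric] b[symmetric]
      c[symmetric] ..
  also have "\<dots> = a * (a * c - b\<^sup>2)"
    by (simp add: power2_eq_square algebra_simps)
  finally have "0 \<le> a * (a * c - b\<^sup>2)" .
  moreover have "0 < a \<or> x = 0\<^sub>v n"
    using scalar_prod_self_pos[OF assms(1)] by (auto simp: a_def)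
  ultimately show ?thesis
    using assms by (auto simp: zero_le_mult_iff a_def b_def c_def)
qed

lemma mult_mat_vec_scalar_prod_transpose:
  fixes A :: "real mat"
  assumes "A \<in> carrier_mat r c" "x \<in> carrier_vec c" "y \<in> carrier_vec r"
  shows "(A *\<^sub>v x) \<bullet> y = x \<bullet> (transpose_mat A *\<^sub>v y)"
  using transpose_vec_mult_scalar[of "transpose_mat A" c r y x] assms by simp

text \<open>
  For \<open>w = A\<^sup>T y\<close>, Cauchy--Schwarz gives \<open>|w|\<^sup>2 = y \<bullet> A w \<le> |y| |A w| \<le> |y| |w|\<close>.
\<close>
lemma transpose_contraction:
  fixes A :: "real mat"
  assumes A: "A \<in> carrier_mat r c" and y: "y \<in> carrier_vec r"
    and contr: "\<And>x. x \<in> carrier_vec c \<Longrightarrow> (A *\<^sub>v x) \<bullet> (A *\<^sub>v x) \<le> x \<bullet> x"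
  shows "(transpose_mat A *\<^sub>v y) \<bullet> (transpose_mat A *\<^sub>v y) \<le> y \<bullet> y"
proof -
  define w where "w = transpose_mat A *\<^sub>v y"
  have w: "w \<in> carrier_vec c"
    using A y by (auto simp: w_def)
  have "w \<bullet> w = y \<bullet> (A *\<^sub>v w)"
    using transpose_vec_mult_scalar[OF A w y] by (simp add: w_def)
  hence "(w \<bullet> w)\<^sup>2 \<le> (y \<bullet> y) * ((A *\<^sub>v w) \<bullet> (A *\<^sub>v w))"
    using scalar_prod_Cauchy_Schwarz[of y r "A *\<^sub>v w"] A w y by auto
  also have "\<dots> \<le> (y \<bullet> y) * (w \<bullet> w)"
    using contr[OF w] scalar_prod_self_nonneg by (intro mult_left_mono)
  finally show ?thesis
    using scalar_prod_self_nonneg[of w] scalar_prod_self_nonneg[of y]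
    by (cases "w \<bullet> w = 0") (auto simp: power2_eq_square w_def[symmetric])
qed

text \<open>
  A crude (Frobenius) bound. Its purpose is that the supremum in \<open>spectral_norm\<close> is taken over
  a set bounded above, so that it dominates each of the elements.
\<close>
lemma mult_mat_vec_bounded:
  fixes A :: "real mat"
  assumes A: "A \<in> carrier_mat r c" and x: "x \<in> carrier_vec c"
  shows "(A *\<^sub>v x) \<bullet> (A *\<^sub>v x) \<le> (\<Sum>i<r. row A i \<bullet> row A i) * (x \<bullet> x)"
proof -
  have "(A *\<^sub>v x) \<bullet> (A *\<^sub>v x) = (\<Sum>i<r. (row A i \<bullet> x)\<^sup>2)"
    using A x by (subst scalar_prod_square[of _ r]) auto
  also have "\<dots> \<le> (\<Sum>i<r. (row A i \<bullet> row A i) * (x \<bullet> x))"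
    using A x by (intro sum_mono scalar_prod_Cauchy_Schwarz[of _ c]) auto
  finally show ?thesis
    by (simp add: sum_distrib_right)
qed

lemma spectral_norm_bound:
  assumes A: "A \<in> carrier_mat r c" and x: "x \<in> carrier_vec c"
  shows "(A *\<^sub>v x) \<bullet> (A *\<^sub>v x) \<le> (spectral_norm A)\<^sup>2 * (x \<bullet> x)"
proof (cases "x = 0\<^sub>v c")
  case True
  then have "A *\<^sub>v x = 0\<^sub>v r"
    using A by (intro eq_vecI) auto
  then show ?thesis
    using True by simp
next
  case False
  let ?U = "{x \<in> carrier_vec (dim_col A). vec_norm2 x = 1}"
  define t where "t = sqrt (x \<bullet> x)"
  have t: "0 < t" "t\<^sup>2 = x \<bullet> x"
    using scalar_prod_self_pos[OF x False] by (auto simp: t_def)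
  define u where "u = (1 / t) \<cdot>\<^sub>v x"
  have u: "u \<in> carrier_vec c"
    using x by (simp add: u_def)
  have "u \<bullet> u = (1 / t)\<^sup>2 * t\<^sup>2"
    using x unfolding t(2) by (simp add: u_def power2_eq_square)
  hence "u \<bullet> u = 1"
    using t(1) by (simp add: power_divide)
  hence uU: "u \<in> ?U"
    using u A by (simp add: vec_norm2_def)
  have "bdd_above ((\<lambda>x. vec_norm2 (A *\<^sub>v x)) ` ?U)"
  proof (rule bdd_aboveI2)
    fix v assume "v \<in> ?U"
    then have "(A *\<^sub>v v) \<bullet> (A *\<^sub>v v) \<le> (\<Sum>i<r. row A i \<bullet> row A i)"
      using mult_mat_vec_bounded[OF A, of v] A by (auto simp: vec_norm2_def)
    then show "vec_norm2 (A *\<^sub>v v) \<le> sqrt (\<Sum>i<r. row A i \<bullet> row A i)"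
      by (simp add: vec_norm2_def)
  qed
  from cSUP_upper[OF uU this] have "vec_norm2 (A *\<^sub>v u) \<le> spectral_norm A"
    by (simp add: spectral_norm_def)
  hence "(vec_norm2 (A *\<^sub>v u))\<^sup>2 \<le> (spectral_norm A)\<^sup>2"
    by (intro power_mono) (simp_all add: vec_norm2_def scalar_prod_self_nonneg)
  moreover have "A *\<^sub>v u = (1 / t) \<cdot>\<^sub>v (A *\<^sub>v x)"
    using A x unfolding u_def by (intro mult_mat_vec)
  hence "(vec_norm2 (A *\<^sub>v u))\<^sup>2 = (1 / t)\<^sup>2 * ((A *\<^sub>v x) \<bullet> (A *\<^sub>v x))"
    using A x
    by (simp add: vec_norm2_def scalar_prod_self_nonneg power2_eq_square
        smult_scalar_prod_distrib[of _ r] scalar_prod_smult_distrib[of _ r])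
  ultimately show ?thesis
    using t scalar_prod_self_pos[OF x False] by (simp add: power_divide divide_le_eq)
qed

text \<open>
  The lower bound on \<open>A\<^sup>T\<close> comes from \<open>|y|\<^sup>2 = y \<bullet> A (B y) = A\<^sup>T y \<bullet> B y\<close> and
  Cauchy--Schwarz, which avoids comparing the spectral norms of \<open>B\<close> and its transpose.
\<close>
lemma spectral_norm_inverse_bound:
  fixes A B :: "real mat"
  assumes A: "A \<in> carrier_mat k k" and B: "B \<in> carrier_mat k k" and AB: "A * B = 1\<^sub>m k"
    and y: "y \<in> carrier_vec k"
  shows "1 / (spectral_norm B)\<^sup>2 * (y \<bullet> y) \<le> (transpose_mat A *\<^sub>v y) \<bullet> (transpose_mat A *\<^sub>v y)"
proof -
  define w where "w = transpose_mat A *\<^sub>v y"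
  have w: "w \<in> carrier_vec k"
    using A y by (auto simp: w_def)
  have By: "B *\<^sub>v y \<in> carrier_vec k"
    using B y by auto
  have "w \<bullet> (B *\<^sub>v y) = y \<bullet> (A *\<^sub>v (B *\<^sub>v y))"
    using transpose_vec_mult_scalar[OF A By y] by (simp add: w_def)
  also have "A *\<^sub>v (B *\<^sub>v y) = y"
    using assoc_mult_mat_vec[OF A B y] AB y by simp
  finally have "(y \<bullet> y)\<^sup>2 \<le> (w \<bullet> w) * ((B *\<^sub>v y) \<bullet> (B *\<^sub>v y))"
    using scalar_prod_Cauchy_Schwarz[OF w By] by simp
  also have "\<dots> \<le> (w \<bullet> w) * ((spectral_norm B)\<^sup>2 * (y \<bullet> y))"
    using spectral_norm_bound[OF B y] scalar_prod_self_nonneg by (intro mult_left_mono)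
  finally have "(y \<bullet> y) * (y \<bullet> y) \<le> ((spectral_norm B)\<^sup>2 * (w \<bullet> w)) * (y \<bullet> y)"
    by (simp add: power2_eq_square mult_ac)
  hence "y \<bullet> y \<le> (spectral_norm B)\<^sup>2 * (w \<bullet> w)"
    using scalar_prod_self_nonneg[of w] scalar_prod_self_nonneg[of y]
    by (cases "y \<bullet> y = 0") auto
  then show ?thesis
    using scalar_prod_self_nonneg[of w] unfolding w_def[symmetric]
    by (cases "spectral_norm B = 0") (auto simp: divide_le_eq mult_ac)
qed

section \<open>Quadratic forms of diagonal and Gram matrices\<close>

lemma transpose_mat_smult: "transpose_mat (a \<cdot>\<^sub>m A) = a \<cdot>\<^sub>m transpose_mat A"
  by (intro eq_matI) auto

lemma smult_mat_mult_vec: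
  fixes A :: "'a :: comm_semiring_0 mat"
  assumes "A \<in> carrier_mat r n" "x \<in> carrier_vec n"
  shows "(a \<cdot>\<^sub>m A) *\<^sub>v x = a \<cdot>\<^sub>v (A *\<^sub>v x)"
  using assms by (intro eq_vecI) (auto simp: scalar_prod_def sum_distrib_left mult.assoc)

lemma mat_diag_scalar_prod:
  fixes f :: "nat \<Rightarrow> real"
  assumes x: "x \<in> carrier_vec n"
  shows "mat_diag n f *\<^sub>v x = vec n (\<lambda>i. f i * x $ i)"
    and "x \<bullet> (mat_diag n f *\<^sub>v x) = (\<Sum>i<n. f i * (x $ i)\<^sup>2)"
proof -
  show *: "mat_diag n f *\<^sub>v x = vec n (\<lambda>i. f i * x $ i)"
    using x
    by (intro eq_vecI)
      (auto simp: mat_diag_def scalar_prod_def if_distrib[of "\<lambda>a. a * _"] cong: if_cong)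
  show "x \<bullet> (mat_diag n f *\<^sub>v x) = (\<Sum>i<n. f i * (x $ i)\<^sup>2)"
    unfolding * using x
    by (auto simp: scalar_prod_def lessThan_atLeast0 power2_eq_square mult_ac intro!: sum.cong)
qed

lemma one_plus_scalar_prod:
  fixes A :: "real mat"
  assumes A: "A \<in> carrier_mat n n" and x: "x \<in> carrier_vec n"
  shows "x \<bullet> ((1\<^sub>m n + A) *\<^sub>v x) = x \<bullet> x + x \<bullet> (A *\<^sub>v x)"
  using A x by (simp add: add_mult_distrib_mat_vec[of _ n n] scalar_prod_add_distrib[of _ n])

lemma gram_scalar_prod:
  fixes A :: "real mat"
  assumes A: "A \<in> carrier_mat r n" and x: "x \<in> carrier_vec n"
  shows "x \<bullet> ((transpose_mat A * A) *\<^sub>v x) = (A *\<^sub>v x) \<bullet> (A *\<^sub>v x)"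
proof -
  have "x \<bullet> ((transpose_mat A * A) *\<^sub>v x) = x \<bullet> (transpose_mat A *\<^sub>v (A *\<^sub>v x))"
    using A x by (subst assoc_mult_mat_vec[of _ n r _ n]) auto
  also have "\<dots> = (A *\<^sub>v x) \<bullet> (A *\<^sub>v x)"
    using A x by (subst mult_mat_vec_scalar_prod_transpose[of _ r n]) auto
  finally show ?thesis .
qed

lemma transpose_gram: "transpose_mat (transpose_mat A * A) = transpose_mat A * (A :: real mat)"
  by (subst transpose_mult[of _ "dim_col A" "dim_row A" _ "dim_col A"]) auto



text \<open>
  The matrix \<open>X\<close> is a factor with \<open>X\<^sup>T X = Y\<^sup>T D Y\<close> for \<open>D = mat_diag k d\<close>. The vector \<open>z\<close> below is
  \<open>D\<^sup>1\<^sup>/\<^sup>2 y\<close>; it reduces the form of \<open>X X\<^sup>T\<close> to estimates of \<open>Y\<^sup>T z\<close>.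
\<close>
lemma weighted_gram:
  fixes Y :: "real mat"
  assumes Y: "Y \<in> carrier_mat k m" and d: "\<And>i. i < k \<Longrightarrow> 0 \<le> d i"
  defines "X \<equiv> mat_diag k (\<lambda>i. sqrt (d i)) * Y"
  shows "X \<in> carrier_mat k m"
    and "x \<in> carrier_vec m \<Longrightarrow> (X *\<^sub>v x) \<bullet> (X *\<^sub>v x) = (\<Sum>i<k. d i * ((Y *\<^sub>v x) $ i)\<^sup>2)"
    and "y \<in> carrier_vec k \<Longrightarrow> \<exists>z \<in> carrier_vec k.
      transpose_mat X *\<^sub>v y = transpose_mat Y *\<^sub>v z \<and> z \<bullet> z = (\<Sum>i<k. d i * (y $ i)\<^sup>2)"
proof -
  define Q where "Q = mat_diag k (\<lambda>i. sqrt (d i))"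
  have Q: "Q \<in> carrier_mat k k" "transpose_mat Q = Q"
    by (auto simp: Q_def mat_diag_def intro!: eq_matI)
  have Qsq: "(Q *\<^sub>v v) \<bullet> (Q *\<^sub>v v) = (\<Sum>i<k. d i * (v $ i)\<^sup>2)" if "v \<in> carrier_vec k" for v
    using that d
    by (auto simp: Q_def mat_diag_scalar_prod(1) scalar_prod_square[of _ k] power_mult_distrib
        intro!: sum.cong)
  show X: "X \<in> carrier_mat k m"
    unfolding X_def by (rule mult_carrier_mat[OF mat_diag_dim Y])
  show "(X *\<^sub>v x) \<bullet> (X *\<^sub>v x) = (\<Sum>i<k. d i * ((Y *\<^sub>v x) $ i)\<^sup>2)" if "x \<in> carrier_vec m"
    using Qsq[of "Y *\<^sub>v x"] assoc_mult_mat_vec[OF Q(1) Y that] Y that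
    by (simp add: X_def Q_def)
  show "\<exists>z \<in> carrier_vec k. transpose_mat X *\<^sub>v y = transpose_mat Y *\<^sub>v z \<and>
      z \<bullet> z = (\<Sum>i<k. d i * (y $ i)\<^sup>2)" if y: "y \<in> carrier_vec k"
  proof (intro bexI conjI)
    have "transpose_mat X = transpose_mat Y * Q"
      using transpose_mult[OF Q(1) Y] Q(2) by (simp add: X_def Q_def)
    then show "transpose_mat X *\<^sub>v y = transpose_mat Y *\<^sub>v (Q *\<^sub>v y)"
      using assoc_mult_mat_vec[of "transpose_mat Y" m k Q k y] Y Q y by simp
  qed (use Qsq[OF y] Q y in auto)
qed

lemma one_plus_gram:
  fixes A :: "real mat"
  assumes A: "A \<in> carrier_mat r n"
  shows "1\<^sub>m n + transpose_mat A * A \<in> carrier_mat n n"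
    and "transpose_mat (1\<^sub>m n + transpose_mat A * A) = 1\<^sub>m n + transpose_mat A * A"
    and "x \<in> carrier_vec n \<Longrightarrow>
      x \<bullet> ((1\<^sub>m n + transpose_mat A * A) *\<^sub>v x) = x \<bullet> x + (A *\<^sub>v x) \<bullet> (A *\<^sub>v x)"
proof -
  have c: "transpose_mat A * A \<in> carrier_mat n n"
    using A by auto
  show "1\<^sub>m n + transpose_mat A * A \<in> carrier_mat n n"
    using c by auto
  show "transpose_mat (1\<^sub>m n + transpose_mat A * A) = 1\<^sub>m n + transpose_mat A * A"
    using c transpose_add[of "1\<^sub>m n" n n "transpose_mat A * A"] transpose_gram[of A] by simp
  show "x \<bullet> ((1\<^sub>m n + transpose_mat A * A) *\<^sub>v x) = x \<bullet> x + (A *\<^sub>v x) \<bullet> (A *\<^sub>v x)"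
    if "x \<in> carrier_vec n"
    using one_plus_scalar_prod[OF c that] gram_scalar_prod[OF A that] by simp
qed

lemma one_plus_mat_diag:
  fixes d :: "nat \<Rightarrow> real"
  shows "1\<^sub>m k + mat_diag k d \<in> carrier_mat k k"
    and "transpose_mat (1\<^sub>m k + mat_diag k d) = 1\<^sub>m k + mat_diag k d"
    and "x \<in> carrier_vec k \<Longrightarrow>
      x \<bullet> ((1\<^sub>m k + mat_diag k d) *\<^sub>v x) = x \<bullet> x + (\<Sum>i<k. d i * (x $ i)\<^sup>2)"
proof -
  show "1\<^sub>m k + mat_diag k d \<in> carrier_mat k k"
    by auto
  show "transpose_mat (1\<^sub>m k + mat_diag k d) = 1\<^sub>m k + mat_diag k d"
    by (auto simp: mat_diag_def intro!: eq_matI)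
  show "x \<bullet> ((1\<^sub>m k + mat_diag k d) *\<^sub>v x) = x \<bullet> x + (\<Sum>i<k. d i * (x $ i)\<^sup>2)"
    if "x \<in> carrier_vec k"
    using that by (simp add: one_plus_scalar_prod mat_diag_scalar_prod(2))
qed

section \<open>Determinant bounds from a bound on the frame\<close>

text \<open>
  With \<open>D = mat_diag k d\<close> the hypotheses say \<open>G \<ge> I + Y\<^sup>T D Y\<close> and \<open>Y Y\<^sup>T \<ge> s I\<close>. The latter
  becomes usable once \<open>Y\<close> stands inside the square roots of \<open>D\<close>, that is, after
  \<open>I + X\<^sup>T X\<close> has been exchanged for \<open>I + X X\<^sup>T\<close>.
\<close>
lemma det_ge_scaled_diag:
  fixes Y G :: "real mat"
  assumes Y: "Y \<in> carrier_mat k m" and d: "\<And>i. i < k \<Longrightarrow> 0 \<le> d i"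
    and G: "G \<in> carrier_mat m m" "transpose_mat G = G"
    and s: "0 \<le> s"
    and expand: "\<And>z. z \<in> carrier_vec k \<Longrightarrow> s * (z \<bullet> z) \<le> (transpose_mat Y *\<^sub>v z) \<bullet> (transpose_mat Y *\<^sub>v z)"
    and le: "\<And>x. x \<in> carrier_vec m \<Longrightarrow> x \<bullet> x + (\<Sum>i<k. d i * ((Y *\<^sub>v x) $ i)\<^sup>2) \<le> x \<bullet> (G *\<^sub>v x)"
  shows "0 < det (1\<^sub>m k + mat_diag k (\<lambda>i. s * d i))"
    and "det (1\<^sub>m k + mat_diag k (\<lambda>i. s * d i)) \<le> det G"
proof -
  define X where "X = mat_diag k (\<lambda>i. sqrt (d i)) * Y"
  have X: "X \<in> carrier_mat k m" "transpose_mat X \<in> carrier_mat m k"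
    using weighted_gram(1)[where d = d, OF Y d] by (auto simp: X_def)
  let ?D = "1\<^sub>m k + mat_diag k (\<lambda>i. s * d i)"
  let ?R = "1\<^sub>m k + transpose_mat (transpose_mat X) * transpose_mat X"
  let ?L = "1\<^sub>m m + transpose_mat X * X"
  have D: "y \<bullet> (?D *\<^sub>v y) = y \<bullet> y + s * (\<Sum>i<k. d i * (y $ i)\<^sup>2)" if "y \<in> carrier_vec k" for y
    using one_plus_mat_diag(3)[OF that, of "\<lambda>i. s * d i"] by (simp add: sum_distrib_left mult.assoc)
  have Dpos: "0 < y \<bullet> (?D *\<^sub>v y)" if "y \<in> carrier_vec k" "y \<noteq> 0\<^sub>v k" for y
    unfolding D[OF that(1)] using scalar_prod_self_pos[OF that] s d
    by (intro add_pos_nonneg mult_nonneg_nonneg sum_nonneg) auto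
  have DR: "y \<bullet> (?D *\<^sub>v y) \<le> y \<bullet> (?R *\<^sub>v y)" if y: "y \<in> carrier_vec k" for y
  proof -
    obtain z where "z \<in> carrier_vec k" "transpose_mat X *\<^sub>v y = transpose_mat Y *\<^sub>v z"
        "z \<bullet> z = (\<Sum>i<k. d i * (y $ i)\<^sup>2)"
      using weighted_gram(3)[where d = d, OF Y d y] unfolding X_def by blast
    then show ?thesis
      unfolding D[OF y] one_plus_gram(3)[OF X(2) y] using expand[of z] by simp
  qed
  show "0 < det ?D"
    using Dpos DR by (intro det_mono_pos_def(1)[OF one_plus_mat_diag(1,2) one_plus_gram(1,2)[OF X(2)]])
  have "det ?D \<le> det ?R"
    using Dpos DR by (intro det_mono_pos_def(2)[OF one_plus_mat_diag(1,2) one_plus_gram(1,2)[OF X(2)]])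
  also have "det ?R = det ?L"
    using det_one_plus_mult_commute[OF X] by simp
  also have "\<dots> \<le> det G"
  proof (rule det_mono_pos_def(2)[OF one_plus_gram(1,2)[OF X(1)] G])
    show "0 < x \<bullet> (?L *\<^sub>v x)" if "x \<in> carrier_vec m" "x \<noteq> 0\<^sub>v m" for x
      unfolding one_plus_gram(3)[OF X(1) that(1)]
      using scalar_prod_self_pos[OF that] scalar_prod_self_nonneg by (intro add_pos_nonneg)
    show "x \<bullet> (?L *\<^sub>v x) \<le> x \<bullet> (G *\<^sub>v x)" if "x \<in> carrier_vec m" for x
      using le[OF that] weighted_gram(2)[where d = d, OF Y d that]
      unfolding one_plus_gram(3)[OF X(1) that] by (simp add: X_def)
  qed
  finally show "det ?D \<le> det G" .
qed

text \<open>
  The reverse comparison: \<open>G \<le> a I + Y\<^sup>T D Y\<close> and \<open>Y Y\<^sup>T \<le> I\<close>. To reach the shape \<open>I + X\<^sup>T X\<close> the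
  factor \<open>a\<close> is taken out, so \<open>X\<close> is built from the weights \<open>d i / a\<close>; pulling \<open>a\<close> out of both
  determinants by the same power \<open>a ^ k\<close> requires \<open>Y\<close> to be square.
\<close>
lemma det_le_shifted_diag:
  fixes Y G :: "real mat"
  assumes Y: "Y \<in> carrier_mat k k" and d: "\<And>i. i < k \<Longrightarrow> 0 \<le> d i"
    and G: "G \<in> carrier_mat k k" "transpose_mat G = G"
    and a: "0 < a"
    and contr: "\<And>z. z \<in> carrier_vec k \<Longrightarrow> (transpose_mat Y *\<^sub>v z) \<bullet> (transpose_mat Y *\<^sub>v z) \<le> z \<bullet> z"
    and pos: "\<And>x. x \<in> carrier_vec k \<Longrightarrow> x \<noteq> 0\<^sub>v k \<Longrightarrow> 0 < x \<bullet> (G *\<^sub>v x)"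
    and le: "\<And>x. x \<in> carrier_vec k \<Longrightarrow>
      x \<bullet> (G *\<^sub>v x) \<le> a * (x \<bullet> x) + (\<Sum>i<k. d i * ((Y *\<^sub>v x) $ i)\<^sup>2)"
  shows "0 < det G" and "det G \<le> det (mat_diag k (\<lambda>i. a + d i))"
proof -
  have d': "0 \<le> d i / a" if "i < k" for i
    using d[OF that] a by simp
  define X where "X = mat_diag k (\<lambda>i. sqrt (d i / a)) * Y"
  have X: "X \<in> carrier_mat k k" "transpose_mat X \<in> carrier_mat k k"
    using weighted_gram(1)[where d = "\<lambda>i. d i / a", OF Y d'] by (auto simp: X_def)
  let ?D = "1\<^sub>m k + mat_diag k (\<lambda>i. d i / a)"
  let ?R = "1\<^sub>m k + transpose_mat (transpose_mat X) * transpose_mat X"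
  let ?L = "1\<^sub>m k + transpose_mat X * X"
  note R = one_plus_gram[OF X(2)] and L = one_plus_gram[OF X(1)]
  have aL: "a \<cdot>\<^sub>m ?L \<in> carrier_mat k k" "transpose_mat (a \<cdot>\<^sub>m ?L) = a \<cdot>\<^sub>m ?L"
    using L(1,2) arg_cong[OF L(2), of "\<lambda>M. a \<cdot>\<^sub>m M"] by (auto simp: transpose_mat_smult)
  have GL: "x \<bullet> (G *\<^sub>v x) \<le> x \<bullet> ((a \<cdot>\<^sub>m ?L) *\<^sub>v x)" if x: "x \<in> carrier_vec k" for x
  proof -
    have "x \<bullet> ((a \<cdot>\<^sub>m ?L) *\<^sub>v x) = a * (x \<bullet> (?L *\<^sub>v x))"
      using L(1) x by (simp add: smult_mat_mult_vec)
    also have "\<dots> = a * (x \<bullet> x) + (\<Sum>i<k. d i * ((Y *\<^sub>v x) $ i)\<^sup>2)"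
      using weighted_gram(2)[where d = "\<lambda>i. d i / a", OF Y d' x] a
      unfolding L(3)[OF x] by (simp add: X_def distrib_left sum_distrib_left)
    finally show ?thesis
      using le[OF x] by simp
  qed
  show "0 < det G"
    using pos GL by (intro det_mono_pos_def(1)[OF G aL])
  have "det G \<le> det (a \<cdot>\<^sub>m ?L)"
    using pos GL by (intro det_mono_pos_def(2)[OF G aL])
  also have "\<dots> = a ^ k * det ?R"
    using L(1) det_one_plus_mult_commute[OF X(2,1)] X(1) by simp
  also have "\<dots> \<le> a ^ k * det ?D"
  proof (rule mult_left_mono)
    show "det ?R \<le> det ?D"
    proof (rule det_mono_pos_def(2)[OF R(1,2) one_plus_mat_diag(1,2)])
      show "0 < y \<bullet> (?R *\<^sub>v y)" if "y \<in> carrier_vec k" "y \<noteq> 0\<^sub>v k" for y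
        unfolding R(3)[OF that(1)]
        using scalar_prod_self_pos[OF that] scalar_prod_self_nonneg by (intro add_pos_nonneg)
      show "y \<bullet> (?R *\<^sub>v y) \<le> y \<bullet> (?D *\<^sub>v y)" if y: "y \<in> carrier_vec k" for y
      proof -
        obtain z where "z \<in> carrier_vec k" "transpose_mat X *\<^sub>v y = transpose_mat Y *\<^sub>v z"
            "z \<bullet> z = (\<Sum>i<k. d i / a * (y $ i)\<^sup>2)"
          using weighted_gram(3)[where d = "\<lambda>i. d i / a", OF Y d' y] unfolding X_def by blast
        then show ?thesis
          unfolding one_plus_mat_diag(3)[OF y] R(3)[OF y] using contr[of z] by simp
      qed
    qed
  qed (use a in simp)
  also have "\<dots> = det (a \<cdot>\<^sub>m ?D)"
    using carrier_matD(2)[OF mat_diag_dim[of k "\<lambda>i. d i / a"]] by simp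
  also have "a \<cdot>\<^sub>m ?D = mat_diag k (\<lambda>i. a + d i)"
    using a by (intro eq_matI) (auto simp: mat_diag_def distrib_left)
  finally show "det G \<le> det (mat_diag k (\<lambda>i. a + d i))" .
qed

section \<open>Eigenvalues\<close>

lemma proots_char_poly_eigendecomposition:
  assumes "K \<in> carrier_mat n n" and V: "orthonormal_mat n V"
    and K: "K = V * mat_diag n f * transpose_mat V"
  shows "proots (char_poly K) = mset (map f [0..<n])"
proof -
  have "similar_mat K (mat_diag n f)"
    using assms by (intro similar_matI[of _ _ V "transpose_mat V" n]) (auto simp: orthonormal_mat_def)
  hence "char_poly K = char_poly (mat_diag n f)"
    by (rule char_poly_similar)
  also have "\<dots> = (\<Prod>a\<leftarrow>diag_mat (mat_diag n f). [:- a, 1:])"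
    by (rule char_poly_upper_triangular[of _ n]) (auto simp: upper_triangular_def mat_diag_def)
  also have "diag_mat (mat_diag n f) = map f [0..<n]"
    by (auto simp: diag_mat_def mat_diag_def)
  finally have cp: "char_poly K = (\<Prod>a\<leftarrow>map f [0..<n]. [:- a, 1:])" .
  have linear: "proots (\<Prod>a\<leftarrow>xs. [:- a, 1:]) = mset xs" for xs :: "real list"
  proof (induction xs)
    case (Cons x xs)
    have "(\<Prod>a\<leftarrow>xs. [:- a, 1:]) \<noteq> 0"
      by (auto simp: prod_list_zero_iff)
    then have "proots ([:- x, 1:] * (\<Prod>a\<leftarrow>xs. [:- a, 1:])) = {#x#} + mset xs"
      using Cons by (subst proots_mult) auto
    then show ?case by simp
  qed simp
  show ?thesis
    unfolding cp by (rule linear)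
qed

text \<open>
  The list behind \<open>eigval\<close> is decreasing, but an index below \<open>n\<close> is within the list only
  because the decomposition makes all \<open>n\<close> roots of the characteristic polynomial real.
\<close>
lemma eigval_antimono:
  assumes "K \<in> carrier_mat n n" and "eigendecomposition n K V" and "i \<le> j" and "j < n"
  shows "eigval K j \<le> eigval K i"
proof -
  define xs where "xs = rev (sorted_list_of_multiset (proots (char_poly K)))"
  have "mset xs = mset (map (eigval K) [0..<n])"
    using proots_char_poly_eigendecomposition[of K n V "eigval K"] assms
    by (simp add: xs_def eigendecomposition_def)
  hence "length xs = n"
    by (metis length_map length_upt minus_nat.diff_0 mset_eq_length)
  moreover have "sorted (rev xs)"
    by (simp add: xs_def)
  ultimately have "xs ! j \<le> xs ! i"
    using assms by (intro sorted_rev_nth_mono) auto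
  then show ?thesis
    by (simp add: eigval_def xs_def)
qed

lemma eigendecomposition_scalar_prod:
  assumes "eigendecomposition n K V" and z: "z \<in> carrier_vec n"
  defines "p \<equiv> transpose_mat V *\<^sub>v z"
  shows "z \<bullet> (K *\<^sub>v z) = (\<Sum>i<n. eigval K i * (p $ i)\<^sup>2)"
    and "z \<bullet> z = (\<Sum>i<n. (p $ i)\<^sup>2)"
proof -
  have V: "V \<in> carrier_mat n n" "V * transpose_mat V = 1\<^sub>m n"
    and K: "K = V * mat_diag n (eigval K) * transpose_mat V"
    using assms by (auto simp: eigendecomposition_def orthonormal_mat_def)
  let ?D = "mat_diag n (eigval K)"
  have p: "p \<in> carrier_vec n"
    using V z by (auto simp: p_def)
  have "K *\<^sub>v z = V *\<^sub>v (?D *\<^sub>v p)"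
    using V z p by (subst K) (simp add: p_def assoc_mult_mat_vec[of _ n n _ n])
  hence "z \<bullet> (K *\<^sub>v z) = p \<bullet> (?D *\<^sub>v p)"
    using transpose_vec_mult_scalar[OF V(1), of "?D *\<^sub>v p" z] p z
    by (simp add: p_def mult_mat_vec_carrier[of _ n n])
  then show "z \<bullet> (K *\<^sub>v z) = (\<Sum>i<n. eigval K i * (p $ i)\<^sup>2)"
    using mat_diag_scalar_prod(2)[OF p] by simp
  have "V *\<^sub>v p = z"
    using V z assoc_mult_mat_vec[of V n n "transpose_mat V" n z] by (simp add: p_def)
  hence "z \<bullet> z = p \<bullet> p"
    using transpose_vec_mult_scalar[OF V(1) p z] by (simp add: p_def)
  then show "z \<bullet> z = (\<Sum>i<n. (p $ i)\<^sup>2)"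
    using scalar_prod_square[OF p] by simp
qed

text \<open>The eigenvalue is the value of the form at the corresponding column of \<open>V\<close>.\<close>
lemma eigval_nonneg:
  assumes K: "psd_mat n K" and ed: "eigendecomposition n K V" and i: "i < n"
  shows "0 \<le> eigval K i"
proof -
  have V: "V \<in> carrier_mat n n" "transpose_mat V * V = 1\<^sub>m n"
    using ed by (auto simp: eigendecomposition_def orthonormal_mat_def)
  define z where "z = V *\<^sub>v unit_vec n i"
  have z: "z \<in> carrier_vec n"
    using V by (auto simp: z_def)
  have "transpose_mat V *\<^sub>v z = unit_vec n i"
    using V assoc_mult_mat_vec[of "transpose_mat V" n n V n "unit_vec n i"] by (simp add: z_def)
  hence "z \<bullet> (K *\<^sub>v z) = (\<Sum>j<n. eigval K j * (unit_vec n i $ j)\<^sup>2)"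
    using eigendecomposition_scalar_prod(1)[OF ed z] by simp
  also have "\<dots> = eigval K i"
    using i by (simp add: unit_vec_def if_distrib[of "\<lambda>a. _ * a\<^sup>2"] cong: if_cong)
  finally show ?thesis
    using K z by (auto simp: psd_mat_def)
qed

section \<open>Selection operators and leading eigenvectors\<close>

lemma selection_op_orthonormal:
  assumes "selection_op n k S"
  shows "S \<in> carrier_mat n k" and "transpose_mat S * S = 1\<^sub>m k"
proof -
  obtain "is" where "is": "length is = k" "distinct is" "set is \<subseteq> {..<n}"
    and S: "S = mat_of_cols n (map (unit_vec n) is)"
    using assms by (auto simp: selection_op_def)
  show c: "S \<in> carrier_mat n k"
    using "is" S by auto
  have col: "col S a = unit_vec n (is ! a)" if "a < k" for a
    using that "is" unfolding S by (subst col_mat_of_cols) auto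
  show "transpose_mat S * S = 1\<^sub>m k"
  proof (rule eq_matI)
    fix a b assume "a < dim_row (1\<^sub>m k :: real mat)" "b < dim_col (1\<^sub>m k :: real mat)"
    then have ab: "a < k" "b < k" by auto
    then have lt: "is ! a < n" "is ! b < n"
      using "is" by (metis lessThan_iff nth_mem subsetD)+
    have "(transpose_mat S * S) $$ (a, b) = unit_vec n (is ! a) \<bullet> (unit_vec n (is ! b) :: real vec)"
      using ab c col by simp
    also have "\<dots> = (if is ! b = is ! a then 1 else 0)"
      using lt by (simp add: unit_vec_def[of n "is ! b"])
    also have "\<dots> = 1\<^sub>m k $$ (a, b)"
      using ab "is" by (auto simp: nth_eq_iff_index_eq)
    finally show "(transpose_mat S * S) $$ (a, b) = 1\<^sub>m k $$ (a, b)" .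
  qed (use c in auto)
qed

lemma first_cols_carrier:
  assumes "V \<in> carrier_mat n m" "k \<le> m"
  shows "first_cols k V \<in> carrier_mat n k"
  using assms by (auto simp: first_cols_def)

lemma transpose_first_cols_mult_vec:
  assumes "V \<in> carrier_mat n m" "k \<le> m" "i < k"
  shows "(transpose_mat (first_cols k V) *\<^sub>v z) $ i = (transpose_mat V *\<^sub>v z) $ i"
proof -
  have "col (first_cols k V) i = col V i"
    using assms unfolding first_cols_def by (subst col_mat_of_cols) auto
  then show ?thesis
    using assms first_cols_carrier[OF assms(1,2)] by simp
qed

lemma selection_op_norm:
  assumes "selection_op n k S" and x: "x \<in> carrier_vec k"
  shows "(S *\<^sub>v x) \<bullet> (S *\<^sub>v x) = x \<bullet> x"
  using gram_scalar_prod[OF selection_op_orthonormal(1)[OF assms(1)] x]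
    selection_op_orthonormal(2)[OF assms(1)] x by simp

lemma information_mat:
  fixes K S :: "real mat" and c :: real
  assumes K: "K \<in> carrier_mat n n" "transpose_mat K = K" and S: "S \<in> carrier_mat n k"
  defines "G \<equiv> c \<cdot>\<^sub>m (transpose_mat S * K * S) + 1\<^sub>m k"
  shows "G \<in> carrier_mat k k" and "transpose_mat G = G"
    and "x \<in> carrier_vec k \<Longrightarrow> x \<bullet> (G *\<^sub>v x) = x \<bullet> x + c * ((S *\<^sub>v x) \<bullet> (K *\<^sub>v (S *\<^sub>v x)))"
proof -
  define M where "M = transpose_mat S * K * S"
  have M: "M \<in> carrier_mat k k"
    using K S by (auto simp: M_def)
  have Mt: "transpose_mat M = M"
    using K S transpose_mult[of "transpose_mat S * K" k n S k] transpose_mult[of "transpose_mat S" k n K n]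
      assoc_mult_mat[of "transpose_mat S" k n K n S k]
    by (simp add: M_def)
  have G: "G = 1\<^sub>m k + c \<cdot>\<^sub>m M"
    using M by (simp add: G_def M_def[symmetric] comm_add_mat[of _ k k])
  show "G \<in> carrier_mat k k"
    using M by (simp add: G)
  show "transpose_mat G = G"
    using M Mt transpose_add[of "1\<^sub>m k" k k "c \<cdot>\<^sub>m M"] by (simp add: G transpose_mat_smult)
  show "x \<bullet> (G *\<^sub>v x) = x \<bullet> x + c * ((S *\<^sub>v x) \<bullet> (K *\<^sub>v (S *\<^sub>v x)))" if x: "x \<in> carrier_vec k"
  proof -
    have Sx: "S *\<^sub>v x \<in> carrier_vec n"
      using S x by auto
    have "M *\<^sub>v x = (transpose_mat S * K) *\<^sub>v (S *\<^sub>v x)"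
      unfolding M_def using K S x by (intro assoc_mult_mat_vec[of _ k n _ k]) auto
    also have "\<dots> = transpose_mat S *\<^sub>v (K *\<^sub>v (S *\<^sub>v x))"
      using K S Sx by (intro assoc_mult_mat_vec[of _ k n _ n]) auto
    finally have "x \<bullet> (M *\<^sub>v x) = (S *\<^sub>v x) \<bullet> (K *\<^sub>v (S *\<^sub>v x))"
      using mult_mat_vec_scalar_prod_transpose[OF S x, of "K *\<^sub>v (S *\<^sub>v x)"] K Sx by simp
    then show ?thesis
      using M x one_plus_scalar_prod[of "c \<cdot>\<^sub>m M" k x] by (simp add: G smult_mat_mult_vec)
  qed
qed

lemma selected_frame_carrier:
  assumes ed: "eigendecomposition n K V" and sel: "selection_op n k S" and "k \<le> n"
  shows "transpose_mat (first_cols k V) * S \<in> carrier_mat k k"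
proof -
  have "V \<in> carrier_mat n n"
    using ed by (auto simp: eigendecomposition_def orthonormal_mat_def)
  from first_cols_carrier[OF this \<open>k \<le> n\<close>] selection_op_orthonormal(1)[OF sel]
  show ?thesis by auto
qed

text \<open>
  All quadratic forms needed for the bounds become sums over one family \<open>p\<close>, the
  eigenvector coordinates of \<open>S x\<close>. Since \<open>S\<close> and \<open>V\<close> preserve lengths, so does \<open>x \<mapsto> p\<close>,
  and \<open>Y x\<close> consists of the first \<open>k\<close> of these coordinates.
\<close>
lemma selected_coordinates:
  assumes ed: "eigendecomposition n K V" and sel: "selection_op n k S" and "k \<le> n"
    and x: "x \<in> carrier_vec k"
  defines "Y \<equiv> transpose_mat (first_cols k V) * S"
  obtains p where "x \<bullet> x = (\<Sum>i<n. (p i)\<^sup>2)"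
    and "(S *\<^sub>v x) \<bullet> (K *\<^sub>v (S *\<^sub>v x)) = (\<Sum>i<n. eigval K i * (p i)\<^sup>2)"
    and "\<And>i. i < k \<Longrightarrow> (Y *\<^sub>v x) $ i = p i"
proof
  let ?p = "\<lambda>i. (transpose_mat V *\<^sub>v (S *\<^sub>v x)) $ i"
  have V: "V \<in> carrier_mat n n"
    using ed by (auto simp: eigendecomposition_def orthonormal_mat_def)
  note Vk = first_cols_carrier[OF V \<open>k \<le> n\<close>] and S = selection_op_orthonormal(1)[OF sel]
  have Sx: "S *\<^sub>v x \<in> carrier_vec n"
    using S x by auto
  show "x \<bullet> x = (\<Sum>i<n. (?p i)\<^sup>2)"
    using eigendecomposition_scalar_prod(2)[OF ed Sx] selection_op_norm[OF sel x] by simp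
  show "(S *\<^sub>v x) \<bullet> (K *\<^sub>v (S *\<^sub>v x)) = (\<Sum>i<n. eigval K i * (?p i)\<^sup>2)"
    by (rule eigendecomposition_scalar_prod(1)[OF ed Sx])
  have "Y *\<^sub>v x = transpose_mat (first_cols k V) *\<^sub>v (S *\<^sub>v x)"
    using assoc_mult_mat_vec[of "transpose_mat (first_cols k V)" k n S k x] Vk S x by (simp add: Y_def)
  then show "(Y *\<^sub>v x) $ i = ?p i" if "i < k" for i
    using transpose_first_cols_mult_vec[OF V \<open>k \<le> n\<close> that] by simp
qed

section \<open>Bounds on the D-optimality criterion\<close>

lemma phi_D_upper:
  assumes "1 \<le> k" "k \<le> n" and psd: "psd_mat n K" and "\<eta> > 0"
    and ed: "eigendecomposition n K V" and sel: "selection_op n k S"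
  shows "phi_D \<eta> K S \<le> ln (det (1\<^sub>m k + (1 / \<eta>\<^sup>2) \<cdot>\<^sub>m mat_diag k (eigval K)))"
proof -
  have K: "K \<in> carrier_mat n n" "transpose_mat K = K"
    using psd by (auto simp: psd_mat_def)
  note S = selection_op_orthonormal(1)[OF sel]
  define c where "c = 1 / \<eta>\<^sup>2"
  have c: "0 < c"
    using \<open>\<eta> > 0\<close> by (simp add: c_def)
  define G where "G = c \<cdot>\<^sub>m (transpose_mat S * K * S) + 1\<^sub>m k"
  note G = information_mat[OF K S, where c = c, folded G_def]
  define Y where "Y = transpose_mat (first_cols k V) * S"
  note Y = selected_frame_carrier[OF ed sel \<open>k \<le> n\<close>, folded Y_def]
  note coords = selected_coordinates[OF ed sel \<open>k \<le> n\<close>, folded Y_def]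
  define l where "l = eigval K (k - 1)"
  have l: "0 \<le> l"
    using eigval_nonneg[OF psd ed, of "k - 1"] assms(1,2) by (simp add: l_def)
  \<comment> \<open>The excess over the least of the first \<open>k\<close> eigenvalues, which dominates all later ones.\<close>
  define d where "d i = c * (eigval K i - l)" for i
  have d: "0 \<le> d i" if "i < k" for i
    using eigval_antimono[OF K(1) ed, of i "k - 1"] that assms(1,2) c by (simp add: d_def l_def)
  have contr: "(Y *\<^sub>v x) \<bullet> (Y *\<^sub>v x) \<le> x \<bullet> x" if x: "x \<in> carrier_vec k" for x
  proof -
    obtain p where p: "x \<bullet> x = (\<Sum>i<n. (p i)\<^sup>2)" "\<And>i. i < k \<Longrightarrow> (Y *\<^sub>v x) $ i = p i"
      using coords[OF x] by blast
    have "(Y *\<^sub>v x) \<bullet> (Y *\<^sub>v x) = (\<Sum>i<k. (p i)\<^sup>2)"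
      using Y x p(2) by (subst scalar_prod_square[of _ k]) auto
    also have "\<dots> \<le> (\<Sum>i<n. (p i)\<^sup>2)"
      using \<open>k \<le> n\<close> by (intro sum_mono2) auto
    finally show ?thesis
      using p(1) by simp
  qed
  have pos: "0 < x \<bullet> (G *\<^sub>v x)" if "x \<in> carrier_vec k" "x \<noteq> 0\<^sub>v k" for x
  proof -
    have "0 \<le> (S *\<^sub>v x) \<bullet> (K *\<^sub>v (S *\<^sub>v x))"
      using psd S that by (auto simp: psd_mat_def)
    then show ?thesis
      unfolding G(3)[OF that(1)] using scalar_prod_self_pos[OF that] c by (intro add_pos_nonneg) auto
  qed
  have le: "x \<bullet> (G *\<^sub>v x) \<le> (1 + c * l) * (x \<bullet> x) + (\<Sum>i<k. d i * ((Y *\<^sub>v x) $ i)\<^sup>2)"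
    if x: "x \<in> carrier_vec k" for x
  proof -
    obtain p where p: "x \<bullet> x = (\<Sum>i<n. (p i)\<^sup>2)"
        "(S *\<^sub>v x) \<bullet> (K *\<^sub>v (S *\<^sub>v x)) = (\<Sum>i<n. eigval K i * (p i)\<^sup>2)"
        "\<And>i. i < k \<Longrightarrow> (Y *\<^sub>v x) $ i = p i"
      using coords[OF x] by blast
    have split: "{..<n} = {..<k} \<union> {k..<n}"
      using \<open>k \<le> n\<close> by auto
    have "(\<Sum>i<n. (eigval K i - l) * (p i)\<^sup>2)
        = (\<Sum>i<k. (eigval K i - l) * (p i)\<^sup>2) + (\<Sum>i=k..<n. (eigval K i - l) * (p i)\<^sup>2)"
      unfolding split by (rule sum.union_disjoint) auto
    also have "(\<Sum>i=k..<n. (eigval K i - l) * (p i)\<^sup>2) \<le> 0"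
      using eigval_antimono[OF K(1) ed, of "k - 1"]
      by (intro sum_nonpos mult_nonpos_nonneg) (auto simp: l_def)
    finally have tail: "c * (\<Sum>i<n. (eigval K i - l) * (p i)\<^sup>2) \<le> c * (\<Sum>i<k. (eigval K i - l) * (p i)\<^sup>2)"
      using c by simp
    have head: "c * (\<Sum>i<k. (eigval K i - l) * (p i)\<^sup>2) = (\<Sum>i<k. d i * ((Y *\<^sub>v x) $ i)\<^sup>2)"
      unfolding sum_distrib_left using p(3) by (intro sum.cong) (auto simp: d_def)
    have total: "(\<Sum>i<n. (eigval K i - l) * (p i)\<^sup>2)
        = (S *\<^sub>v x) \<bullet> (K *\<^sub>v (S *\<^sub>v x)) - l * (x \<bullet> x)"
      unfolding p by (simp add: left_diff_distrib sum_subtractf sum_distrib_left)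
    show ?thesis
      using tail unfolding head total G(3)[OF x] by (simp add: algebra_simps)
  qed
  have "0 < 1 + c * l"
    using c l by (intro add_pos_nonneg) auto
  note bound = det_le_shifted_diag[where d = d, OF Y d G(1,2) this transpose_contraction[OF Y _ contr] pos le]
  have "mat_diag k (\<lambda>i. 1 + c * l + d i) = 1\<^sub>m k + c \<cdot>\<^sub>m mat_diag k (eigval K)"
    by (intro eq_matI) (auto simp: mat_diag_def d_def algebra_simps)
  with bound have "0 < det G" "det G \<le> det (1\<^sub>m k + c \<cdot>\<^sub>m mat_diag k (eigval K))"
    by simp_all
  moreover have "phi_D \<eta> K S = ln (det G)"
    using S by (simp add: phi_D_def G_def c_def)
  ultimately show ?thesis
    by (simp add: c_def)
qed

lemma phi_D_lower:
  assumes "k \<le> n" and psd: "psd_mat n K" and "\<eta> > 0"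
    and ed: "eigendecomposition n K V" and sel: "selection_op n k S"
    and full_rank: "vec_space.rank k (transpose_mat (first_cols k V) * S) = k"
  shows "ln (det (1\<^sub>m k + (1 / (spectral_norm (mat_inv (transpose_mat (first_cols k V) * S)))\<^sup>2) \<cdot>\<^sub>m
    ((1 / \<eta>\<^sup>2) \<cdot>\<^sub>m mat_diag k (eigval K)))) \<le> phi_D \<eta> K S"
proof -
  have K: "K \<in> carrier_mat n n" "transpose_mat K = K"
    using psd by (auto simp: psd_mat_def)
  note S = selection_op_orthonormal(1)[OF sel]
  define c where "c = 1 / \<eta>\<^sup>2"
  have c: "0 < c"
    using \<open>\<eta> > 0\<close> by (simp add: c_def)
  define G where "G = c \<cdot>\<^sub>m (transpose_mat S * K * S) + 1\<^sub>m k"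
  note G = information_mat[OF K S, where c = c, folded G_def]
  define Y where "Y = transpose_mat (first_cols k V) * S"
  note Y = selected_frame_carrier[OF ed sel \<open>k \<le> n\<close>, folded Y_def]
  note coords = selected_coordinates[OF ed sel \<open>k \<le> n\<close>, folded Y_def]
  have "det Y \<noteq> 0"
    using full_rank vec_space.det_rank_iff[OF Y] by (simp add: Y_def)
  hence "Y \<in> Units (ring_mat TYPE(real) k ())"
    using det_non_zero_imp_unit[OF Y] by simp
  then obtain B where B: "mat_inverse Y = Some B"
    using mat_inverse(1)[OF Y, where b = "()"] by (cases "mat_inverse Y") auto
  have inv: "mat_inv Y = B" "Y * B = 1\<^sub>m k" "B \<in> carrier_mat k k"
    using mat_inverse(2)[OF Y B] B by (auto simp: mat_inv_def)
  define s where "s = 1 / (spectral_norm B)\<^sup>2"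
  define d where "d i = c * eigval K i" for i
  have nonneg: "0 \<le> eigval K i" if "i < n" for i
    using eigval_nonneg[OF psd ed that] .
  have d: "0 \<le> d i" if "i < k" for i
    using nonneg[of i] that \<open>k \<le> n\<close> c by (simp add: d_def)
  have s: "0 \<le> s"
    by (simp add: s_def)
  have expand: "s * (z \<bullet> z) \<le> (transpose_mat Y *\<^sub>v z) \<bullet> (transpose_mat Y *\<^sub>v z)"
    if "z \<in> carrier_vec k" for z
    unfolding s_def by (rule spectral_norm_inverse_bound[OF Y inv(3,2) that])
  have le: "x \<bullet> x + (\<Sum>i<k. d i * ((Y *\<^sub>v x) $ i)\<^sup>2) \<le> x \<bullet> (G *\<^sub>v x)"
    if x: "x \<in> carrier_vec k" for x
  proof -
    obtain p where p: "(S *\<^sub>v x) \<bullet> (K *\<^sub>v (S *\<^sub>v x)) = (\<Sum>i<n. eigval K i * (p i)\<^sup>2)"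
        "\<And>i. i < k \<Longrightarrow> (Y *\<^sub>v x) $ i = p i"
      using coords[OF x] by blast
    have "(\<Sum>i<k. d i * ((Y *\<^sub>v x) $ i)\<^sup>2) = c * (\<Sum>i<k. eigval K i * (p i)\<^sup>2)"
      unfolding sum_distrib_left using p(2) by (intro sum.cong) (auto simp: d_def)
    also have "\<dots> \<le> c * (\<Sum>i<n. eigval K i * (p i)\<^sup>2)"
      using c nonneg \<open>k \<le> n\<close> by (intro mult_left_mono sum_mono2) auto
    finally show ?thesis
      unfolding G(3)[OF x] p(1) by simp
  qed
  note bound = det_ge_scaled_diag[where d = d, OF Y d G(1,2) s expand le]
  have "1\<^sub>m k + mat_diag k (\<lambda>i. s * d i) = 1\<^sub>m k + s \<cdot>\<^sub>m (c \<cdot>\<^sub>m mat_diag k (eigval K))"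
    by (intro eq_matI) (auto simp: mat_diag_def d_def)
  with bound have "0 < det (1\<^sub>m k + s \<cdot>\<^sub>m (c \<cdot>\<^sub>m mat_diag k (eigval K)))"
      "det (1\<^sub>m k + s \<cdot>\<^sub>m (c \<cdot>\<^sub>m mat_diag k (eigval K))) \<le> det G"
    by simp_all
  moreover have "phi_D \<eta> K S = ln (det G)"
    using S by (simp add: phi_D_def G_def c_def)
  ultimately show ?thesis
    unfolding Y_def[symmetric] inv(1) s_def[symmetric] c_def[symmetric] by simp
qed

theorem theorem1:
  fixes n k :: nat and \<eta> :: real and K V S\<^sub>o\<^sub>p\<^sub>t S :: "real mat"
  defines "\<Lambda>\<^sub>k \<equiv> mat_diag k (eigval K)"
    and "V\<^sub>k \<equiv> first_cols k V"
  assumes "1 \<le> k" and "k < n"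
    and "psd_mat n K"
    and "\<eta> > 0"
    and "eigendecomposition n K V"
    and "D_optimal n k \<eta> K S\<^sub>o\<^sub>p\<^sub>t"
    and "selection_op n k S"
    and "vec_space.rank k (transpose_mat V\<^sub>k * S) = k"
  shows "ln (det (1\<^sub>m k + (1 / \<eta>\<^sup>2) \<cdot>\<^sub>m \<Lambda>\<^sub>k)) \<ge> phi_D \<eta> K S\<^sub>o\<^sub>p\<^sub>t
    \<and> phi_D \<eta> K S\<^sub>o\<^sub>p\<^sub>t \<ge> phi_D \<eta> K S
    \<and> phi_D \<eta> K S \<ge> ln (det (1\<^sub>m k +
        (1 / (spectral_norm (mat_inv (transpose_mat V\<^sub>k * S)))\<^sup>2) \<cdot>\<^sub>m ((1 / \<eta>\<^sup>2) \<cdot>\<^sub>m \<Lambda>\<^sub>k)))"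
proof (intro conjI)
  show "phi_D \<eta> K S\<^sub>o\<^sub>p\<^sub>t \<le> ln (det (1\<^sub>m k + (1 / \<eta>\<^sup>2) \<cdot>\<^sub>m \<Lambda>\<^sub>k))"
    using assms phi_D_upper[of k n K \<eta> V "S\<^sub>o\<^sub>p\<^sub>t"] by (simp add: D_optimal_def)
  show "phi_D \<eta> K S \<le> phi_D \<eta> K S\<^sub>o\<^sub>p\<^sub>t"
    using assms by (simp add: D_optimal_def)
  show "ln (det (1\<^sub>m k + (1 / (spectral_norm (mat_inv (transpose_mat V\<^sub>k * S)))\<^sup>2) \<cdot>\<^sub>m
      ((1 / \<eta>\<^sup>2) \<cdot>\<^sub>m \<Lambda>\<^sub>k))) \<le> phi_D \<eta> K S"
    using assms phi_D_lower[of k n K \<eta> V S] by simp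
qed

end
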